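(* Let $m_{\mathrm{eff}}$ be the effective mass of the variable-order fractional vibrator $$m\frac{d^{\alpha(\omega)}x(t)}{dt^{\alpha(\omega)}}+c\frac{d^{\beta(\omega)}x(t)}{dt^{\beta(\omega)}}+k\frac{d^{\lambda(\omega)}x(t)}{dt^{\lambda(\omega)}}=f(t),\qquad 1<\alpha(\omega)<3,\ 0<\beta(\omega)<2,\ 0\le\lambda(\omega)<1.$$ Then $$m_{\mathrm{eff}}=-\left[m\omega^{\alpha(\omega)-2}\cos\frac{\alpha(\omega)\pi}{2}+c\omega^{\beta(\omega)-2}\cos\frac{\beta(\omega)\pi}{2}\right].$$
   Context: $m,c,k>0$ are constants (primary mass, damping coefficient, stiffness), $\omega>0$ is the vibration frequency, and $\alpha,\beta,\lambda$ are real functions of $\omega$. Derivatives of fractional order are Weyl derivatives: the Fourier transform of the derivative of order $v(\omega)$ of $x$ is $(i\omega)^{v(\omega)}X(\omega)$, with principal value $i^v=\cos\frac{v\pi}{2}+i\sin\frac{v\pi}{2}$. The vibrator's equivalent motion equation (the left-hand sides having equal Fourier transforms, with $\omega$-dependent coefficients acting by multiplication in the Fourier domain) is $$-\left[m\omega^{\alpha-2}\cos\frac{\alpha\pi}{2}+c\omega^{\beta-2}\cos\frac{\beta\pi}{2}\right]\frac{d^2x}{dt^2}+\left[m\omega^{\alpha-1}\sin\frac{\alpha\pi}{2}+c\omega^{\beta-1}\sin\frac{\beta\pi}{2}+k\omega^{\lambda-1}\sin\frac{\lambda\pi}{2}\right]\frac{dx}{dt}+k\omega^{\lambda}\cos\frac{\lambda\pi}{2}\,x=f(t),$$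 where $\alpha=\alpha(\omega)$, $\beta=\beta(\omega)$, $\lambda=\lambda(\omega)$. The effective mass is by definition the coefficient of $x''(t)$ in this equivalent equation. *)

theory Defs
  imports "HOL-Analysis.Analysis"
begin

text \<open>Convention for the Fourier transform: kernel \<open>exp (- \<i> \<omega> t)\<close>, no normalising factor,
  so that \<open>d/dt\<close> becomes multiplication by \<open>\<i> \<omega>\<close>.\<close>

definition fourier :: "(real \<Rightarrow> real) \<Rightarrow> real \<Rightarrow> complex" where
  "fourier x \<omega> = (\<integral>t. exp (- (\<i> * of_real \<omega> * of_real t)) * of_real (x t) \<partial>lborel)"

text \<open>Fourier transform at \<open>\<omega>\<close> of the Weyl derivative of variable order \<open>v \<omega>\<close> of \<open>x\<close>.  The Weyl
  derivative is specified through this transform.  The complex \<open>powr\<close> is the principal branch,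
  so \<open>\<i> powr v = cos (v * pi / 2) + \<i> * sin (v * pi / 2)\<close>.\<close>

definition fourier_weyl :: "(real \<Rightarrow> real) \<Rightarrow> (real \<Rightarrow> real) \<Rightarrow> real \<Rightarrow> complex" where
  "fourier_weyl v x \<omega> = (\<i> * of_real \<omega>) powr of_real (v \<omega>) * fourier x \<omega>"

text \<open>Motions on which the two equations are compared: \<open>x\<close> is \<open>C\<^sup>2\<close>, and
  \<open>x\<close>, \<open>x'\<close>, \<open>x''\<close> are integrable, so that all three have Fourier transforms.\<close>

definition motions :: "(real \<Rightarrow> real) set" where
  "motions = {x. x differentiable_on UNIV \<and> deriv x differentiable_on UNIV \<and>
     continuous_on UNIV (deriv (deriv x)) \<and>
     integrable lborel x \<and> integrable lborel (deriv x) \<and> integrable lborel (deriv (deriv x))}"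

text \<open>Fourier transforms of the left-hand sides of
  \<open>m D\<^sup>\<alpha> x + c D\<^sup>\<beta> x + k D\<^sup>\<lambda> x = f\<close> and of \<open>M x'' + C x' + K x = f\<close>; the frequency-dependent
  coefficients \<open>M\<close>, \<open>C\<close>, \<open>K\<close> act by multiplication in the Fourier domain.\<close>

definition fractional_lhs ::
  "real \<Rightarrow> real \<Rightarrow> real \<Rightarrow> (real \<Rightarrow> real) \<Rightarrow> (real \<Rightarrow> real) \<Rightarrow> (real \<Rightarrow> real) \<Rightarrow>
   (real \<Rightarrow> real) \<Rightarrow> real \<Rightarrow> complex" where
  "fractional_lhs m c k \<alpha> \<beta> l x \<omega> =
     of_real m * fourier_weyl \<alpha> x \<omega> + of_real c * fourier_weyl \<beta> x \<omega>
     + of_real k * fourier_weyl l x \<omega>"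

definition second_order_lhs ::
  "(real \<Rightarrow> real) \<Rightarrow> (real \<Rightarrow> real) \<Rightarrow> (real \<Rightarrow> real) \<Rightarrow> (real \<Rightarrow> real) \<Rightarrow> real \<Rightarrow> complex" where
  "second_order_lhs M C K x \<omega> =
     of_real (M \<omega>) * fourier (deriv (deriv x)) \<omega> + of_real (C \<omega>) * fourier (deriv x) \<omega>
     + of_real (K \<omega>) * fourier x \<omega>"

text \<open>\<open>M x'' + C x' + K x = f\<close> is the equivalent motion equation of the fractional vibrator.
  Equality of the transforms (first conjunct) alone fixes only \<open>C\<close> and \<open>K - \<omega>\<^sup>2 M\<close>, because both
  \<open>x''\<close> and \<open>x\<close> have real Fourier symbols.  The second conjunct fixes how this real part is
  shared out: the restoring term \<open>k D\<^sup>\<lambda> x\<close> by itself is equivalent to some \<open>C\<^sub>k x' + K x\<close>, so the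
  in-phase parts of \<open>m D\<^sup>\<alpha> x\<close> and \<open>c D\<^sup>\<beta> x\<close> go to \<open>x''\<close> and that of \<open>k D\<^sup>\<lambda> x\<close> goes to \<open>x\<close>.\<close>

definition equivalent_equation ::
  "real \<Rightarrow> real \<Rightarrow> real \<Rightarrow> (real \<Rightarrow> real) \<Rightarrow> (real \<Rightarrow> real) \<Rightarrow> (real \<Rightarrow> real) \<Rightarrow>
   (real \<Rightarrow> real) \<Rightarrow> (real \<Rightarrow> real) \<Rightarrow> (real \<Rightarrow> real) \<Rightarrow> bool" where
  "equivalent_equation m c k \<alpha> \<beta> l M C K \<longleftrightarrow>
     (\<forall>x\<in>motions. \<forall>\<omega>>0. second_order_lhs M C K x \<omega> = fractional_lhs m c k \<alpha> \<beta> l x \<omega>) \<and>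
     (\<exists>Ck. \<forall>x\<in>motions. \<forall>\<omega>>0.
        second_order_lhs (\<lambda>_. 0) Ck K x \<omega> = of_real k * fourier_weyl l x \<omega>)"

text \<open>The coefficient of \<open>x''\<close> in the equivalent motion equation; the coefficients are
  determined at positive frequencies only, hence the description of the value at \<open>\<omega>\<close>.\<close>

definition effective_mass ::
  "real \<Rightarrow> real \<Rightarrow> real \<Rightarrow> (real \<Rightarrow> real) \<Rightarrow> (real \<Rightarrow> real) \<Rightarrow> (real \<Rightarrow> real) \<Rightarrow> real \<Rightarrow> real" where
  "effective_mass m c k \<alpha> \<beta> l \<omega> =
     (THE \<mu>. \<exists>M C K. equivalent_equation m c k \<alpha> \<beta> l M C K \<and> \<mu> = M \<omega>)"

end

theory Submission imports Defs "HOL-Probability.Characteristic_Functions"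
begin

text \<open>On motions, both left-hand sides act in the Fourier domain as multiplication by a complex
  symbol.  Two integrations by parts give the symbol
  \<open>(K - \<omega>\<^sup>2 M) + \<i> \<omega> C\<close> of \<open>M x'' + C x' + K x\<close>, and polar coordinates on the positive imaginary axis
  give \<open>\<omega>\<^sup>v cos (v \<pi> / 2) + \<i> \<omega>\<^sup>v sin (v \<pi> / 2)\<close> as the symbol of the Weyl derivative of order \<open>v\<close>.

  Equality of the transforms for all motions is the same as equality of the symbols, because a
  single motion has a transform without zeros: the Gaussian density, whose transform is again a
  Gaussian (\<open>multipliers_agree_iff\<close>).  Comparing real and imaginary parts turns the notion of
  equivalent equation into three real equations at each frequency (\<open>equivalent_equation_iff\<close>):
  the condition on the restoring term gives \<open>K\<close>, the imaginary part of the full equation gives \<open>C\<close>,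
  and what is left of the real part reads
  \<open>- \<omega>\<^sup>2 M = m \<omega>\<^sup>\<alpha> cos (\<alpha> \<pi> / 2) + c \<omega>\<^sup>\<beta> cos (\<beta> \<pi> / 2)\<close>.
  For \<open>\<omega> > 0\<close> these equations are linear with a unique solution, which is both the existence of
  the stated equation and the uniqueness behind the description in \<open>effective_mass\<close>.\<close>

section \<open>Fourier transform of a derivative\<close>

text \<open>A nonzero limit would keep the norm above a positive constant on a half-line, which has
  infinite measure.\<close>
lemma limit_of_integrable_eq_0:
  fixes h :: "real \<Rightarrow> 'a::{banach,second_countable_topology}"
  assumes int: "integrable lborel h" and lim: "(h \<longlongrightarrow> L) at_top"
  shows "L = 0"
proof (rule ccontr)
  assume "L \<noteq> 0"
  define e where "e = norm L / 2"
  have e: "e > 0" using \<open>L \<noteq> 0\<close> by (simp add: e_def)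
  have "((\<lambda>t. norm (h t)) \<longlongrightarrow> norm L) at_top" by (intro tendsto_norm lim)
  moreover have "e < norm L" using e by (simp add: e_def)
  ultimately have "\<forall>\<^sub>F t in at_top. e < norm (h t)"
    by (rule order_tendstoD)
  then obtain A where A: "\<And>t. A \<le> t \<Longrightarrow> e < norm (h t)"
    by (auto simp: eventually_at_top_linorder)
  define J where "J = (\<integral>t. norm (h t) \<partial>lborel)"
  \<comment> \<open>Chebyshev's inequality on an interval of arbitrary length \<open>b\<close> inside that half-line.\<close>
  have J: "e * b \<le> J" if "b \<ge> 0" for b
  proof -
    have "(\<integral>t. e * indicator {A..A+b} t \<partial>lborel) \<le> J"
      unfolding J_def
    proof (rule integral_mono)
      show "integrable lborel (\<lambda>t. e * indicator {A..A+b} t)"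
        by (rule integrable_mult_right, rule integrable_real_indicator)
            (auto simp: emeasure_lborel_Icc_eq)
      show "e * indicator {A..A+b} t \<le> norm (h t)" for t
        using A[of t] by (auto split: split_indicator)
    qed (use int in auto)
    then show ?thesis using that by simp
  qed
  have "J \<ge> 0" by (simp add: J_def)
  then have "e * ((J + 1) / e) \<le> J"
    using e by (intro J) auto
  then show False using e by simp
qed

text \<open>The integral of \<open>g'\<close> is the limit of \<open>g T - g (- T)\<close> as \<open>T\<close> grows.  That difference is itself an
  integrable function of \<open>T\<close>, so its limit is \<open>0\<close>; in this way one does not have to show separately
  that \<open>g\<close> vanishes at both ends.\<close>
lemma integral_derivative_eq_0:
  fixes g g' :: "real \<Rightarrow> 'a::euclidean_space"
  assumes der: "\<And>t. (g has_vector_derivative g' t) (at t)"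
    and cont: "continuous_on UNIV g'"
    and g: "integrable lborel g" and g': "integrable lborel g'"
  shows "(\<integral>t. g' t \<partial>lborel) = 0"
proof -
  have "((\<lambda>T. \<integral>t. indicator {-T..T} t *\<^sub>R g' t \<partial>lborel) \<longlongrightarrow> (\<integral>t. g' t \<partial>lborel)) at_top"
  proof (rule integral_dominated_convergence_at_top)
    show "integrable lborel (\<lambda>t. norm (g' t))" using g' by simp
    show "AE t in lborel. ((\<lambda>T. indicator {-T..T} t *\<^sub>R g' t) \<longlongrightarrow> g' t) at_top"
    proof (rule AE_I2)
      fix t :: real
      have "\<forall>\<^sub>F T in at_top. indicator {-T..T} t *\<^sub>R g' t = g' t"
        using eventually_ge_at_top[of "\<bar>t\<bar>"] by eventually_elim (auto simp: indicator_def)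
      then show "((\<lambda>T. indicator {-T..T} t *\<^sub>R g' t) \<longlongrightarrow> g' t) at_top"
        by (rule tendsto_eventually)
    qed
    show "\<forall>\<^sub>F T in at_top. AE t in lborel. norm (indicator {-T..T} t *\<^sub>R g' t) \<le> norm (g' t)"
      by (auto split: split_indicator)
  qed (use g' in \<open>auto intro!: borel_measurable_scaleR\<close>)
  moreover have "\<forall>\<^sub>F T in at_top. (\<integral>t. indicator {-T..T} t *\<^sub>R g' t \<partial>lborel) = g T - g (- T)"
    using eventually_ge_at_top[of 0]
  proof eventually_elim
    case (elim T)
    show ?case
      by (rule integral_FTC_Icc)
        (use elim in \<open>auto intro: continuous_on_subset[OF cont] has_vector_derivative_at_within der\<close>)
  qed
  ultimately have "((\<lambda>T. g T - g (- T)) \<longlongrightarrow> (\<integral>t. g' t \<partial>lborel)) at_top"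
    by (rule Lim_transform_eventually)
  moreover have "integrable lborel (\<lambda>T. g T - g (- T))"
    using g lborel_integrable_real_affine[OF g, of "-1" 0] by simp
  ultimately show ?thesis by (intro limit_of_integrable_eq_0)
qed

lemma integrable_fourier_kernel:
  assumes "integrable lborel f"
  shows "integrable lborel (\<lambda>t. exp (- (\<i> * of_real \<omega> * of_real t)) * complex_of_real (f t))"
  by (rule Bochner_Integration.integrable_bound[OF assms])
    (use assms in \<open>auto simp: norm_mult norm_exp_eq_Re\<close>)

text \<open>Integration by parts: the product of the kernel with \<open>f\<close> has derivative
  \<open>k f' - \<i> \<omega> k f\<close>, where \<open>k\<close> is the kernel, and this derivative integrates to \<open>0\<close>.\<close>
lemma fourier_derivative:
  assumes der: "\<And>t. (f has_field_derivative f' t) (at t)"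
    and cont: "continuous_on UNIV f'"
    and f: "integrable lborel f" and f': "integrable lborel f'"
  shows "fourier f' \<omega> = \<i> * of_real \<omega> * fourier f \<omega>"
proof -
  let ?k = "\<lambda>t. exp (- (\<i> * of_real \<omega> * of_real t)) :: complex"
  let ?g = "\<lambda>t. ?k t * of_real (f t)"
  let ?g' = "\<lambda>t. ?k t * of_real (f' t) - (\<i> * of_real \<omega>) * ?g t"
  have f_cont: "continuous_on UNIV f"
    by (meson DERIV_continuous_on has_field_derivative_at_within der)
  have "(\<integral>t. ?g' t \<partial>lborel) = 0"
  proof (rule integral_derivative_eq_0)
    show "(?g has_vector_derivative ?g' t) (at t)" for t
    proof -
      have k: "(?k has_vector_derivative - (\<i> * of_real \<omega>) * ?k t) (at t)"
        by (auto intro!: derivative_eq_intros has_vector_derivative_real_field simp: algebra_simps)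
      have "((\<lambda>t. complex_of_real (f t)) has_vector_derivative of_real (f' t)) (at t)"
        using der[of t] by (intro has_vector_derivative_of_real)
      from has_vector_derivative_mult[OF k this] show ?thesis
        by (simp add: algebra_simps)
    qed
    show "continuous_on UNIV ?g'"
      by (intro continuous_intros cont f_cont)
    show "integrable lborel ?g" by (rule integrable_fourier_kernel[OF f])
    show "integrable lborel ?g'"
      by (intro Bochner_Integration.integrable_diff integrable_mult_right integrable_fourier_kernel f f')
  qed
  then show ?thesis
    unfolding fourier_def
    by (subst (asm) Bochner_Integration.integral_diff)
      (auto intro!: integrable_mult_right integrable_fourier_kernel f f')
qed

lemma fourier_deriv_motion:
  assumes "x \<in> motions"
  shows "fourier (deriv x) \<omega> = \<i> * of_real \<omega> * fourier x \<omega>"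
    and "fourier (deriv (deriv x)) \<omega> = - (of_real \<omega>)\<^sup>2 * fourier x \<omega>"
proof -
  have D1: "(x has_field_derivative deriv x t) (at t)"
   and D2: "(deriv x has_field_derivative deriv (deriv x) t) (at t)" for t
    using assms by (auto simp: motions_def differentiable_on_def DERIV_deriv_iff_real_differentiable)
  show 1: "fourier (deriv x) \<omega> = \<i> * of_real \<omega> * fourier x \<omega>"
    using assms by (intro fourier_derivative D1)
      (auto simp: motions_def intro: differentiable_imp_continuous_on)
  have "fourier (deriv (deriv x)) \<omega> = \<i> * of_real \<omega> * fourier (deriv x) \<omega>"
    using assms by (intro fourier_derivative D2) (auto simp: motions_def)
  then show "fourier (deriv (deriv x)) \<omega> = - (of_real \<omega>)\<^sup>2 * fourier x \<omega>"
    unfolding 1 by (simp add: power2_eq_square algebra_simps)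
qed

section \<open>Powers on the imaginary axis\<close>

text \<open>The principal logarithm of \<open>\<i> \<omega>\<close> is \<open>ln \<omega> + \<i> \<pi> / 2\<close>.\<close>
lemma imaginary_axis_powr:
  assumes "\<omega> > 0"
  shows "(\<i> * of_real \<omega>) powr of_real v
       = Complex (\<omega> powr v * cos (v * pi / 2)) (\<omega> powr v * sin (v * pi / 2))"
proof -
  have "Ln (\<i> * of_real \<omega>) = Complex (ln \<omega>) (pi / 2)"
    using assms Ln_times_of_real[of \<omega> \<i>]
    by (subst mult.commute, subst Ln_times_of_real) (auto simp: complex_eq_iff)
  then have "(\<i> * of_real \<omega>) powr of_real v = exp (of_real v * Complex (ln \<omega>) (pi / 2))"
    using assms by (simp add: powr_def)
  then show ?thesis
    using assms by (simp add: complex_eq_iff Re_exp Im_exp powr_def)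
qed

section \<open>Equations as Fourier multipliers\<close>

text \<open>The transform is the characteristic function of the standard normal distribution at \<open>- \<omega>\<close>.
  In particular it has no zeros, so the Gaussian tests multipliers at all frequencies at once.\<close>
lemma fourier_std_normal_density:
  "fourier std_normal_density \<omega> = of_real (exp (- \<omega>\<^sup>2 / 2))"
proof -
  have "fourier std_normal_density \<omega> = char std_normal_distribution (- \<omega>)"
    unfolding fourier_def char_def
    by (subst integral_density) (auto simp: normal_density_nonneg scaleR_conv_of_real mult_ac)
  then show ?thesis by (simp add: char_std_normal_distribution)
qed

text \<open>The derivatives of the Gaussian are polynomials times the Gaussian, and the Gaussian has all
  moments.\<close>
lemma std_normal_density_in_motions: "std_normal_density \<in> motions"
proof -
  let ?\<phi> = std_normal_density
  have D1: "(?\<phi> has_field_derivative - (t * ?\<phi> t)) (at t)" for t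
  proof -
    have "((\<lambda>t. exp (- t\<^sup>2 / 2)) has_real_derivative - (t * exp (- t\<^sup>2 / 2))) (at t)"
      by (auto intro!: derivative_eq_intros)
    from DERIV_cmult[OF this, of "1 / sqrt (2 * pi)"] show ?thesis
      unfolding std_normal_density_def by (simp add: mult_ac)
  qed
  have D2: "((\<lambda>t. - (t * ?\<phi> t)) has_field_derivative (t\<^sup>2 * ?\<phi> t - ?\<phi> t)) (at t)" for t
    by (auto intro!: derivative_eq_intros D1 simp: power2_eq_square)
  have d1: "deriv ?\<phi> = (\<lambda>t. - (t * ?\<phi> t))"
    using D1 by (intro ext DERIV_imp_deriv)
  have d2: "deriv (deriv ?\<phi>) = (\<lambda>t. t\<^sup>2 * ?\<phi> t - ?\<phi> t)"
    unfolding d1 using D2 by (intro ext DERIV_imp_deriv)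
  have mom: "integrable lborel (\<lambda>t. t ^ n * ?\<phi> t)" for n
    using integrable_std_normal_moment[of n] by (simp add: mult.commute)
  have cont: "continuous_on UNIV ?\<phi>"
    by (meson DERIV_continuous_on has_field_derivative_at_within D1)
  have "?\<phi> differentiable_on UNIV" "deriv ?\<phi> differentiable_on UNIV"
    unfolding d1 differentiable_on_def real_differentiable_def using D1 D2 by blast+
  moreover have "continuous_on UNIV (deriv (deriv ?\<phi>))"
    unfolding d2 by (intro continuous_on_diff continuous_on_mult continuous_on_power continuous_on_id cont)
  moreover have "integrable lborel ?\<phi>" "integrable lborel (deriv ?\<phi>)"
    unfolding d1 using mom[of 0] mom[of 1] by simp_all
  moreover have "integrable lborel (deriv (deriv ?\<phi>))"
    unfolding d2 using mom[of 0] mom[of 2] by (intro Bochner_Integration.integrable_diff) simp_all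
  ultimately show ?thesis
    unfolding motions_def by blast
qed

text \<open>Testing on the Gaussian, whose transform can be cancelled, shows that the operators determine
  their multipliers.\<close>
lemma multipliers_agree_iff:
  assumes "\<And>x \<omega>. x \<in> motions \<Longrightarrow> \<omega> > 0 \<Longrightarrow> A x \<omega> = p \<omega> * fourier x \<omega>"
    and "\<And>x \<omega>. x \<in> motions \<Longrightarrow> \<omega> > 0 \<Longrightarrow> B x \<omega> = q \<omega> * fourier x \<omega>"
  shows "(\<forall>x\<in>motions. \<forall>\<omega>>0. A x \<omega> = B x \<omega>) \<longleftrightarrow> (\<forall>\<omega>>0. p \<omega> = q \<omega>)"
proof
  assume eq: "\<forall>x\<in>motions. \<forall>\<omega>>0. A x \<omega> = B x \<omega>"
  show "\<forall>\<omega>>0. p \<omega> = q \<omega>"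
  proof (intro allI impI)
    fix \<omega> :: real
    assume "\<omega> > 0"
    with eq std_normal_density_in_motions
    have "p \<omega> * fourier std_normal_density \<omega> = q \<omega> * fourier std_normal_density \<omega>"
      by (metis assms)
    then show "p \<omega> = q \<omega>"
      by (simp add: fourier_std_normal_density)
  qed
next
  assume "\<forall>\<omega>>0. p \<omega> = q \<omega>"
  then show "\<forall>x\<in>motions. \<forall>\<omega>>0. A x \<omega> = B x \<omega>"
    using assms by metis
qed

lemma second_order_lhs_symbol:
  assumes "x \<in> motions"
  shows "second_order_lhs M C K x \<omega> = Complex (K \<omega> - \<omega>\<^sup>2 * M \<omega>) (\<omega> * C \<omega>) * fourier x \<omega>"
  unfolding second_order_lhs_def fourier_deriv_motion[OF assms]
  by (simp add: Complex_eq algebra_simps)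

lemma fourier_weyl_symbol:
  assumes "\<omega> > 0"
  shows "fourier_weyl v x \<omega>
       = Complex (\<omega> powr v \<omega> * cos (v \<omega> * pi / 2)) (\<omega> powr v \<omega> * sin (v \<omega> * pi / 2)) * fourier x \<omega>"
  unfolding fourier_weyl_def imaginary_axis_powr[OF assms] by (rule refl)

lemma fractional_lhs_symbol:
  assumes "\<omega> > 0"
  shows "fractional_lhs m c k \<alpha> \<beta> l x \<omega> =
    Complex
     (m * \<omega> powr \<alpha> \<omega> * cos (\<alpha> \<omega> * pi / 2) + c * \<omega> powr \<beta> \<omega> * cos (\<beta> \<omega> * pi / 2)
        + k * \<omega> powr l \<omega> * cos (l \<omega> * pi / 2))
     (m * \<omega> powr \<alpha> \<omega> * sin (\<alpha> \<omega> * pi / 2) + c * \<omega> powr \<beta> \<omega> * sin (\<beta> \<omega> * pi / 2)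
        + k * \<omega> powr l \<omega> * sin (l \<omega> * pi / 2)) * fourier x \<omega>"
  unfolding fractional_lhs_def fourier_weyl_symbol[OF assms]
  by (simp add: Complex_eq distrib_left distrib_right mult.assoc)

section \<open>The coefficients of the equivalent equation\<close>

text \<open>This is the comparison of real and imaginary parts of the symbols.  The restoring term decides
  how the real part splits between \<open>M\<close> and \<open>K\<close>; its damping coefficient \<open>Ck\<close> is existentially
  quantified and can always be chosen to match the imaginary part, so only the condition on \<open>K\<close>
  survives.\<close>
lemma equivalent_equation_iff:
  "equivalent_equation m c k \<alpha> \<beta> l M C K \<longleftrightarrow>
    (\<forall>\<omega>>0. K \<omega> = k * \<omega> powr l \<omega> * cos (l \<omega> * pi / 2) \<and>
      - (\<omega>\<^sup>2 * M \<omega>) = m * \<omega> powr \<alpha> \<omega> * cos (\<alpha> \<omega> * pi / 2) + c * \<omega> powr \<beta> \<omega> * cos (\<beta> \<omega> * pi / 2) \<and>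
      \<omega> * C \<omega> = m * \<omega> powr \<alpha> \<omega> * sin (\<alpha> \<omega> * pi / 2) + c * \<omega> powr \<beta> \<omega> * sin (\<beta> \<omega> * pi / 2)
        + k * \<omega> powr l \<omega> * sin (l \<omega> * pi / 2))"
proof -
  have total: "(\<forall>x\<in>motions. \<forall>\<omega>>0.
        second_order_lhs M C K x \<omega> = fractional_lhs m c k \<alpha> \<beta> l x \<omega>) \<longleftrightarrow>
    (\<forall>\<omega>>0. Complex (K \<omega> - \<omega>\<^sup>2 * M \<omega>) (\<omega> * C \<omega>) = Complex
      (m * \<omega> powr \<alpha> \<omega> * cos (\<alpha> \<omega> * pi / 2) + c * \<omega> powr \<beta> \<omega> * cos (\<beta> \<omega> * pi / 2)
        + k * \<omega> powr l \<omega> * cos (l \<omega> * pi / 2))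
      (m * \<omega> powr \<alpha> \<omega> * sin (\<alpha> \<omega> * pi / 2) + c * \<omega> powr \<beta> \<omega> * sin (\<beta> \<omega> * pi / 2)
        + k * \<omega> powr l \<omega> * sin (l \<omega> * pi / 2)))"
    by (intro multipliers_agree_iff second_order_lhs_symbol fractional_lhs_symbol)
  \<comment> \<open>The same comparison for the restoring term, whose equivalent equation has no \<open>x''\<close> term.\<close>
  have weyl: "of_real k * fourier_weyl l x \<omega> =
      Complex (k * \<omega> powr l \<omega> * cos (l \<omega> * pi / 2)) (k * \<omega> powr l \<omega> * sin (l \<omega> * pi / 2))
        * fourier x \<omega>" if "\<omega> > 0" for x \<omega>
    unfolding fourier_weyl_symbol[OF that] Complex_eq by (simp add: algebra_simps)
  have "(\<forall>x\<in>motions. \<forall>\<omega>>0.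
        second_order_lhs (\<lambda>_. 0) Ck K x \<omega> = of_real k * fourier_weyl l x \<omega>) \<longleftrightarrow>
    (\<forall>\<omega>>0. Complex (K \<omega> - \<omega>\<^sup>2 * 0) (\<omega> * Ck \<omega>) =
      Complex (k * \<omega> powr l \<omega> * cos (l \<omega> * pi / 2)) (k * \<omega> powr l \<omega> * sin (l \<omega> * pi / 2)))" for Ck
    by (intro multipliers_agree_iff second_order_lhs_symbol weyl)
  moreover have "\<exists>Ck. \<forall>\<omega>>0. \<omega> * Ck \<omega> = k * \<omega> powr l \<omega> * sin (l \<omega> * pi / 2)"
    by (rule exI[of _ "\<lambda>\<omega>. k * \<omega> powr l \<omega> * sin (l \<omega> * pi / 2) / \<omega>"]) simp
  ultimately have restoring: "(\<exists>Ck. \<forall>x\<in>motions. \<forall>\<omega>>0.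
        second_order_lhs (\<lambda>_. 0) Ck K x \<omega> = of_real k * fourier_weyl l x \<omega>) \<longleftrightarrow>
    (\<forall>\<omega>>0. K \<omega> = k * \<omega> powr l \<omega> * cos (l \<omega> * pi / 2))"
    unfolding complex.inject mult_zero_right diff_zero by blast
  show ?thesis
    unfolding equivalent_equation_def total restoring complex.inject by fastforce
qed

theorem theorem2p2:
  fixes m c k :: real and \<alpha> \<beta> l :: "real \<Rightarrow> real"
  assumes "m > 0" and "c > 0" and "k > 0"
    and "\<forall>\<omega>>0. 1 < \<alpha> \<omega> \<and> \<alpha> \<omega> < 3"
    and "\<forall>\<omega>>0. 0 < \<beta> \<omega> \<and> \<beta> \<omega> < 2"
    and "\<forall>\<omega>>0. 0 \<le> l \<omega> \<and> l \<omega> < 1"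
  shows "equivalent_equation m c k \<alpha> \<beta> l
      (\<lambda>\<omega>. - (m * \<omega> powr (\<alpha> \<omega> - 2) * cos (\<alpha> \<omega> * pi / 2)
              + c * \<omega> powr (\<beta> \<omega> - 2) * cos (\<beta> \<omega> * pi / 2)))
      (\<lambda>\<omega>. m * \<omega> powr (\<alpha> \<omega> - 1) * sin (\<alpha> \<omega> * pi / 2)
              + c * \<omega> powr (\<beta> \<omega> - 1) * sin (\<beta> \<omega> * pi / 2)
              + k * \<omega> powr (l \<omega> - 1) * sin (l \<omega> * pi / 2))
      (\<lambda>\<omega>. k * \<omega> powr (l \<omega>) * cos (l \<omega> * pi / 2))
    \<and> (\<forall>\<omega>>0. effective_mass m c k \<alpha> \<beta> l \<omega> =
          - (m * \<omega> powr (\<alpha> \<omega> - 2) * cos (\<alpha> \<omega> * pi / 2)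
             + c * \<omega> powr (\<beta> \<omega> - 2) * cos (\<beta> \<omega> * pi / 2)))"
proof -
  let ?M = "\<lambda>\<omega>. - (m * \<omega> powr (\<alpha> \<omega> - 2) * cos (\<alpha> \<omega> * pi / 2)
              + c * \<omega> powr (\<beta> \<omega> - 2) * cos (\<beta> \<omega> * pi / 2))"
  let ?C = "\<lambda>\<omega>. m * \<omega> powr (\<alpha> \<omega> - 1) * sin (\<alpha> \<omega> * pi / 2)
              + c * \<omega> powr (\<beta> \<omega> - 1) * sin (\<beta> \<omega> * pi / 2)
              + k * \<omega> powr (l \<omega> - 1) * sin (l \<omega> * pi / 2)"
  let ?K = "\<lambda>\<omega>. k * \<omega> powr (l \<omega>) * cos (l \<omega> * pi / 2)"
  have eq: "equivalent_equation m c k \<alpha> \<beta> l ?M ?C ?K"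
  proof -
    \<comment> \<open>The factors \<open>\<omega>\<^sup>2\<close> and \<open>\<omega>\<close> come from the symbols of \<open>x''\<close> and \<open>x'\<close>; they restore the
      exponents lowered by \<open>2\<close> and \<open>1\<close> in the coefficients.\<close>
    have p2: "\<omega>\<^sup>2 * (a * \<omega> powr (v - 2) * b) = a * \<omega> powr v * b" if "\<omega> > 0" for a b v \<omega> :: real
      using that by (simp add: powr_diff)
    have p1: "\<omega> * (a * \<omega> powr (v - 1) * b) = a * \<omega> powr v * b" if "\<omega> > 0" for a b v \<omega> :: real
      using that by (simp add: powr_diff)
    show ?thesis
      unfolding equivalent_equation_iff
      by (intro allI impI) (simp only: distrib_left mult_minus_right minus_minus p1 p2)
  qed
  have unique: "M \<omega> = ?M \<omega>"
    if "equivalent_equation m c k \<alpha> \<beta> l M C K" and "\<omega> > 0" for M C K \<omega>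
  proof -
    have "- (\<omega>\<^sup>2 * M \<omega>) = - (\<omega>\<^sup>2 * ?M \<omega>)"
      using that eq unfolding equivalent_equation_iff by simp
    then show ?thesis using that(2) by simp
  qed
  have "effective_mass m c k \<alpha> \<beta> l \<omega> = ?M \<omega>" if "\<omega> > 0" for \<omega>
    unfolding effective_mass_def using eq unique that by (intro the_equality) blast+
  with eq show ?thesis by blast
qed

end
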